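(* Let $M=M_1\coprod M_2$ be the metric sum of two pointed metric spaces $M_1$ and $M_2$, and let $Y$ be a Banach space. If the pair $(M,Y)$ has the Lip-BPB property, then so do $(M_1,Y)$ and $(M_2,Y)$.
   Context: All metric spaces are complete and all Banach spaces are real. A pointed metric space is a metric space $(M,d)$ with a distinguished point $0\in M$. For a Banach space $Y$, $\mathrm{Lip}_0(M,Y)$ is the Banach space of Lipschitz maps $F\colon M\to Y$ with $F(0)=0$, with the norm $\|F\|_L=\sup\{\|F(p)-F(q)\|/d(p,q)\colon p,q\in M,\ p\neq q\}$. The pair $(M,Y)$ has the Lipschitz Bishop-Phelps-Bollobás property (Lip-BPB property) if for every $\varepsilon>0$ there is $\eta(\varepsilon)>0$ such that for every $F\in\mathrm{Lip}_0(M,Y)$ with $\|F\|_L=1$ and all $p\neq q$ in $M$ with $\|F(p)-F(q)\|>(1-\eta(\varepsilon))\,d(p,q)$, there exist $G\in\mathrm{Lip}_0(M,Y)$ and $r\neq s$ in $M$ such that $$\frac{\|G(r)-G(s)\|}{d(r,s)}=\|G\|_L=1,\qquad \|G-F\|_L<\varepsilon,\qquad \frac{d(p,r)+d(q,s)}{d(p,q)}<\varepsilon.$$ The (metric) sum $M_1\coprod M_2$ of pointed metric spaces $(M_1,d_1)$, $(M_2,d_2)$ is their disjoint union with the base points identified to one point $0$ (the base point), with the metric $d(x,y)=d_i(x,y)$ if $x,y\in M_i$, and $d(x,y)=d_i(x,0)+d_j(0,y)$ if $x\in M_i$, $y\in M_j$, $i\neq j$. *)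

theory Defs
  imports "HOL-Analysis.Analysis"
begin

text \<open>
  Metric spaces are values of the library type \<open>'a metric\<close> (carrier \<open>mspace M\<close>, distance \<open>mdist M\<close>),
  and the distinguished point of a pointed metric space is a separate argument \<open>z \<in> mspace M\<close>.
\<close>

text \<open>
  Functions are total, so an element of \<open>Lip0 M z\<close> is unconstrained outside \<open>mspace M\<close>;
  everything below depends only on its values on \<open>mspace M\<close>.
\<close>

definition Lip0 :: "'a metric \<Rightarrow> 'a \<Rightarrow> ('a \<Rightarrow> 'y::real_normed_vector) set" where
  "Lip0 M z = {F. Lipschitz_continuous_map M euclidean_metric F \<and> F z = 0}"

text \<open>
  The element \<open>0\<close> is inserted because \<open>Sup {}\<close> is unspecified for reals: the norm on the zero space
  \<open>Lip0 M z\<close> over a one-point \<open>M\<close> has to be \<open>0\<close>.  For larger \<open>M\<close> it does not change the supremum.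
\<close>

definition lip_norm :: "'a metric \<Rightarrow> ('a \<Rightarrow> 'y::real_normed_vector) \<Rightarrow> real" where
  "lip_norm M F =
     Sup (insert 0 {norm (F p - F q) / mdist M p q | p q. p \<in> mspace M \<and> q \<in> mspace M \<and> p \<noteq> q})"

definition Lip_BPB :: "'a metric \<Rightarrow> 'a \<Rightarrow> 'y::banach itself \<Rightarrow> bool" where
  "Lip_BPB M z (Y :: 'y itself) \<longleftrightarrow>
     (\<forall>\<epsilon>>0. \<exists>\<eta>>0. \<forall>F \<in> (Lip0 M z :: ('a \<Rightarrow> 'y) set). lip_norm M F = 1 \<longrightarrow>
        (\<forall>p \<in> mspace M. \<forall>q \<in> mspace M.
           p \<noteq> q \<and> norm (F p - F q) > (1 - \<eta>) * mdist M p q \<longrightarrow>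
           (\<exists>G \<in> (Lip0 M z :: ('a \<Rightarrow> 'y) set). \<exists>r \<in> mspace M. \<exists>s \<in> mspace M. r \<noteq> s \<and>
              norm (G r - G s) / mdist M r s = lip_norm M G \<and> lip_norm M G = 1 \<and>
              lip_norm M (\<lambda>x. G x - F x) < \<epsilon> \<and>
              (mdist M p r + mdist M q s) / mdist M p q < \<epsilon>)))"

text \<open>
  The metric sum: in the disjoint union, the point \<open>Inr z2\<close> is left out, so that \<open>Inl z1\<close> plays the
  role of both base points and is the base point of the sum.
\<close>

definition msum_carrier :: "'a metric \<Rightarrow> 'b metric \<Rightarrow> 'b \<Rightarrow> ('a + 'b) set" where
  "msum_carrier M1 M2 z2 = Inl ` mspace M1 \<union> Inr ` (mspace M2 - {z2})"

fun msum_dist :: "'a metric \<Rightarrow> 'a \<Rightarrow> 'b metric \<Rightarrow> 'b \<Rightarrow> 'a + 'b \<Rightarrow> 'a + 'b \<Rightarrow> real" where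
  "msum_dist M1 z1 M2 z2 (Inl x) (Inl y) = mdist M1 x y"
| "msum_dist M1 z1 M2 z2 (Inr x) (Inr y) = mdist M2 x y"
| "msum_dist M1 z1 M2 z2 (Inl x) (Inr y) = mdist M1 x z1 + mdist M2 z2 y"
| "msum_dist M1 z1 M2 z2 (Inr x) (Inl y) = mdist M2 x z2 + mdist M1 z1 y"

definition msum :: "'a metric \<Rightarrow> 'a \<Rightarrow> 'b metric \<Rightarrow> 'b \<Rightarrow> ('a + 'b) metric" where
  "msum M1 z1 M2 z2 = metric (msum_carrier M1 M2 z2, msum_dist M1 z1 M2 z2)"

lemma Metric_space_msum:
  assumes "z1 \<in> mspace M1" "z2 \<in> mspace M2"
  shows "Metric_space (msum_carrier M1 M2 z2) (msum_dist M1 z1 M2 z2)"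
proof
  fix x y
  show "0 \<le> msum_dist M1 z1 M2 z2 x y"
    by (cases x; cases y) auto
  show "msum_dist M1 z1 M2 z2 x y = msum_dist M1 z1 M2 z2 y x"
    by (cases x; cases y) (auto simp: mdist_commute)
next
  fix x y
  assume "x \<in> msum_carrier M1 M2 z2" "y \<in> msum_carrier M1 M2 z2"
  then show "msum_dist M1 z1 M2 z2 x y = 0 \<longleftrightarrow> x = y"
    using assms by (cases x; cases y) (auto simp: msum_carrier_def add_nonneg_eq_0_iff)
next
  fix x y w
  assume "x \<in> msum_carrier M1 M2 z2" "y \<in> msum_carrier M1 M2 z2" "w \<in> msum_carrier M1 M2 z2"
  then show "msum_dist M1 z1 M2 z2 x w \<le> msum_dist M1 z1 M2 z2 x y + msum_dist M1 z1 M2 z2 y w"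
    using assms mdist_triangle[of _ M1] mdist_triangle[of _ M2]
      mdist_nonneg[of M1] mdist_nonneg[of M2] mdist_commute[of M1] mdist_commute[of M2]
    apply (cases x; cases y; cases w)
           apply (auto simp: msum_carrier_def)
    by (smt (verit))+
qed

lemma
  assumes "z1 \<in> mspace M1" "z2 \<in> mspace M2"
  shows mspace_msum: "mspace (msum M1 z1 M2 z2) = msum_carrier M1 M2 z2"
    and mdist_msum: "mdist (msum M1 z1 M2 z2) = msum_dist M1 z1 M2 z2"
  using Metric_space_msum[OF assms]
  by (simp_all add: msum_def Metric_space.mspace_metric Metric_space.mdist_metric)

end

theory Submission
  imports Defs
begin

text \<open>
  Let \<open>\<rho>\<close> be the retraction of the sum onto one summand that collapses the other summand to the
  base point.  Given \<open>F\<close> on the summand, apply the hypothesis to \<open>F \<circ> \<rho>\<close>, which has the same norm,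
  with \<open>min \<epsilon> 1\<close> in place of \<open>\<epsilon>\<close>, and restrict the resulting \<open>G\<close>.  If \<open>G\<close> attains its norm at
  \<open>r, s\<close>, then the restriction attains it at \<open>\<rho> r, \<rho> s\<close>, because a shortest path from \<open>r\<close> to \<open>s\<close>
  passes through \<open>\<rho> r\<close> and \<open>\<rho> s\<close> and \<open>G\<close> must have slope one along each piece.  The points \<open>\<rho> r\<close>
  and \<open>\<rho> s\<close> are distinct: otherwise \<open>d(p,r) + d(q,s) \<ge> d(p, \<rho> r) + d(q, \<rho> s) \<ge> d(p,q)\<close>.
\<close>

section \<open>The Lipschitz norm as the least nonnegative Lipschitz constant\<close>

lemma mdist_self [simp]: "x \<in> mspace M \<Longrightarrow> mdist M x x = 0"
  by simp

lemma mdist_pos: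
  assumes "x \<in> mspace M" "y \<in> mspace M" "x \<noteq> y"
  shows "mdist M x y > 0"
  using assms mdist_zero[of x M y] mdist_nonneg[of M x y] by linarith

lemma Lip0_iff:
  "F \<in> Lip0 M z \<longleftrightarrow>
    (\<exists>B. \<forall>x\<in>mspace M. \<forall>y\<in>mspace M. norm (F x - F y) \<le> B * mdist M x y) \<and> F z = 0"
  by (auto simp: Lip0_def Lipschitz_continuous_map_def dist_norm)

lemma bdd_above_Lip0:
  assumes "F \<in> Lip0 M z"
  shows "bdd_above (insert 0 {norm (F p - F q) / mdist M p q | p q.
    p \<in> mspace M \<and> q \<in> mspace M \<and> p \<noteq> q})"
proof -
  from assms obtain B where
    B: "\<And>x y. x \<in> mspace M \<Longrightarrow> y \<in> mspace M \<Longrightarrow> norm (F x - F y) \<le> B * mdist M x y"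
    by (auto simp: Lip0_iff)
  have "norm (F p - F q) / mdist M p q \<le> B"
    if "p \<in> mspace M" "q \<in> mspace M" "p \<noteq> q" for p q
  proof -
    have "mdist M p q > 0"
      using that mdist_pos by metis
    with B[OF that(1,2)] show ?thesis
      by (simp add: divide_simps)
  qed
  \<comment> \<open>\<open>B\<close> can be negative when \<open>M\<close> has at most one point, so
    the inserted 0 calls for the maximum.\<close>
  then show ?thesis
    by (intro bdd_aboveI[of _ "max 0 B"]) (auto simp: le_max_iff_disj)
qed

lemma lip_norm_nonneg:
  assumes "F \<in> Lip0 M z"
  shows "0 \<le> lip_norm M F"
  unfolding lip_norm_def using bdd_above_Lip0[OF assms] by (intro cSup_upper) auto

lemma norm_diff_le_lip_norm:
  assumes "F \<in> Lip0 M z" "x \<in> mspace M" "y \<in> mspace M"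
  shows "norm (F x - F y) \<le> lip_norm M F * mdist M x y"
proof (cases "x = y")
  case True
  then show ?thesis using assms by simp
next
  case False
  then have "mdist M x y > 0"
    using assms mdist_pos by metis
  moreover have "norm (F x - F y) / mdist M x y \<le> lip_norm M F"
    unfolding lip_norm_def using bdd_above_Lip0[OF assms(1)] assms False
    by (intro cSup_upper) auto
  ultimately show ?thesis
    by (simp add: divide_simps)
qed

lemma lip_norm_le:
  assumes "0 \<le> B"
    and B: "\<And>x y. x \<in> mspace M \<Longrightarrow> y \<in> mspace M \<Longrightarrow> norm (F x - F y) \<le> B * mdist M x y"
  shows "lip_norm M F \<le> B"
proof -
  have "norm (F p - F q) / mdist M p q \<le> B"
    if "p \<in> mspace M" "q \<in> mspace M" "p \<noteq> q" for p q
  proof -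
    have "mdist M p q > 0"
      using that mdist_pos by metis
    with B[OF that(1,2)] show ?thesis
      by (simp add: divide_simps)
  qed
  with assms(1) show ?thesis
    unfolding lip_norm_def by (intro cSup_least) auto
qed

lemma Lip0_diff:
  assumes "F \<in> Lip0 M z" "G \<in> Lip0 M z"
  shows "(\<lambda>x. F x - G x) \<in> Lip0 M z"
proof -
  have "norm (F x - G x - (F y - G y)) \<le> (lip_norm M F + lip_norm M G) * mdist M x y"
    if "x \<in> mspace M" "y \<in> mspace M" for x y
  proof -
    have "norm (F x - G x - (F y - G y)) \<le> norm (F x - F y) + norm (G x - G y)"
      using norm_triangle_ineq4[of "F x - F y" "G x - G y"] by (simp add: algebra_simps)
    with norm_diff_le_lip_norm[OF assms(1) that] norm_diff_le_lip_norm[OF assms(2) that]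
    show ?thesis by (simp add: algebra_simps)
  qed
  then have "\<exists>B. \<forall>x\<in>mspace M. \<forall>y\<in>mspace M.
      norm (F x - G x - (F y - G y)) \<le> B * mdist M x y"
    by blast
  then show ?thesis
    using assms by (simp add: Lip0_iff)
qed

text \<open>Kept general in \<open>f\<close> because it serves twice: for restriction along an
  isometric embedding and for extension along a retraction.\<close>

lemma Lip0_comp:
  assumes "F \<in> Lip0 M z" and "f z' = z"
    and f: "\<And>x. x \<in> mspace N \<Longrightarrow> f x \<in> mspace M"
    and le: "\<And>x y. x \<in> mspace N \<Longrightarrow> y \<in> mspace N \<Longrightarrow> mdist M (f x) (f y) \<le> mdist N x y"
  shows Lip0_comp_mem: "F \<circ> f \<in> Lip0 N z'"
    and lip_norm_comp_le: "lip_norm N (F \<circ> f) \<le> lip_norm M F"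
proof -
  have *: "norm ((F \<circ> f) x - (F \<circ> f) y) \<le> lip_norm M F * mdist N x y"
    if "x \<in> mspace N" "y \<in> mspace N" for x y
  proof -
    have "norm ((F \<circ> f) x - (F \<circ> f) y) \<le> lip_norm M F * mdist M (f x) (f y)"
      using norm_diff_le_lip_norm[OF assms(1)] f that by simp
    also have "\<dots> \<le> lip_norm M F * mdist N x y"
      using le[OF that] lip_norm_nonneg[OF assms(1)] by (rule mult_left_mono)
    finally show ?thesis .
  qed
  then show "F \<circ> f \<in> Lip0 N z'"
    using assms(1,2) unfolding Lip0_iff by auto
  show "lip_norm N (F \<circ> f) \<le> lip_norm M F"
    using lip_norm_nonneg[OF assms(1)] * by (rule lip_norm_le)
qed

section \<open>Passage of the Lip-BPB property to a retract\<close>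

text \<open>
  The assumption \<open>split\<close> makes \<open>i\<close> isometric, since \<open>\<rho> \<circ> i\<close> is the identity.
\<close>

locale metric_retract =
  fixes M :: "'a metric" and z :: 'a and N :: "'n metric" and z' :: 'n
    and i :: "'a \<Rightarrow> 'n" and \<rho> :: "'n \<Rightarrow> 'a"
  assumes i_mem: "x \<in> mspace M \<Longrightarrow> i x \<in> mspace N"
    and rho_mem: "y \<in> mspace N \<Longrightarrow> \<rho> y \<in> mspace M"
    and rho_i: "x \<in> mspace M \<Longrightarrow> \<rho> (i x) = x"
    and base_mem: "z \<in> mspace M"
    and i_base: "i z = z'"
    and split: "\<lbrakk>u \<in> mspace N; v \<in> mspace N; \<rho> u \<noteq> \<rho> v\<rbrakk> \<Longrightarrow>
      mdist N u v = mdist N u (i (\<rho> u)) + mdist M (\<rho> u) (\<rho> v) + mdist N (i (\<rho> v)) v"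
begin

lemma rho_base: "\<rho> z' = z"
  using rho_i[OF base_mem] i_base by simp

lemma dist_i:
  assumes "x \<in> mspace M" "y \<in> mspace M"
  shows "mdist N (i x) (i y) = mdist M x y"
  using assms split[of "i x" "i y"] by (cases "x = y") (simp_all add: i_mem rho_i)

text \<open>For distinct images, the left side is one of the three nonnegative summands that
  \<open>split\<close> gives for \<open>mdist N u v\<close>.\<close>

lemma dist_rho:
  assumes "u \<in> mspace N" "v \<in> mspace N"
  shows "mdist M (\<rho> u) (\<rho> v) \<le> mdist N u v"
  using assms split[of u v] by (cases "\<rho> u = \<rho> v") (simp_all add: rho_mem)

lemma Lip0_restrict:
  assumes "G \<in> Lip0 N z'"
  shows "G \<circ> i \<in> Lip0 M z" "lip_norm M (G \<circ> i) \<le> lip_norm N G"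
  by (rule Lip0_comp[where f = i, OF assms i_base]; simp add: i_mem dist_i)+

lemma Lip0_extend:
  assumes "F \<in> Lip0 M z"
  shows "F \<circ> \<rho> \<in> Lip0 N z'" "lip_norm N (F \<circ> \<rho>) \<le> lip_norm M F"
  by (rule Lip0_comp[where f = \<rho>, OF assms rho_base]; simp add: rho_mem dist_rho)+

text \<open>Restricting \<open>F \<circ> \<rho>\<close> along the isometric \<open>i\<close> gives
  back \<open>F\<close>, so the extension cannot have smaller norm. Equality is needed because the
  hypothesis on \<open>N\<close> speaks only of maps of norm exactly 1.\<close>

lemma lip_norm_extend:
  assumes "F \<in> Lip0 M z"
  shows "lip_norm N (F \<circ> \<rho>) = lip_norm M F"
proof (rule antisym[OF Lip0_extend(2)[OF assms]], rule lip_norm_le)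
  show "0 \<le> lip_norm N (F \<circ> \<rho>)"
    by (rule lip_norm_nonneg[OF Lip0_extend(1)[OF assms]])
next
  fix x y assume "x \<in> mspace M" "y \<in> mspace M"
  then show "norm (F x - F y) \<le> lip_norm N (F \<circ> \<rho>) * mdist M x y"
    using norm_diff_le_lip_norm[OF Lip0_extend(1)[OF assms], of "i x" "i y"]
    by (simp add: i_mem rho_i dist_i)
qed

lemma norm_attained_rho:
  assumes G: "G \<in> Lip0 N z'" "lip_norm N G = 1"
    and rs: "r \<in> mspace N" "s \<in> mspace N" "\<rho> r \<noteq> \<rho> s"
    and attained: "norm (G r - G s) = mdist N r s"
  shows "norm (G (i (\<rho> r)) - G (i (\<rho> s))) = mdist M (\<rho> r) (\<rho> s)"
proof -
  let ?r = "i (\<rho> r)" and ?s = "i (\<rho> s)"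
  have mem: "?r \<in> mspace N" "?s \<in> mspace N"
    using rs by (auto intro: i_mem rho_mem)
  have lip: "norm (G x - G y) \<le> mdist N x y" if "x \<in> mspace N" "y \<in> mspace N" for x y
    using norm_diff_le_lip_norm[OF G(1) that] G(2) by simp
  \<comment> \<open>By \<open>attained\<close> and \<open>split\<close> the left side is the sum of
    three lengths. Each term on the right is at most the corresponding length, so none can fall
    short, in particular not the middle one.\<close>
  have "norm (G r - G s) \<le> norm (G r - G ?r) + norm (G ?r - G ?s) + norm (G ?s - G s)"
    using norm_triangle_ineq[of "G r - G ?r" "G ?r - G ?s"]
      norm_triangle_ineq[of "G r - G ?s" "G ?s - G s"] by simp
  moreover have "mdist N ?r ?s = mdist M (\<rho> r) (\<rho> s)"
    using rs by (simp add: dist_i rho_mem)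
  ultimately show ?thesis
    using attained split[OF rs] lip[OF rs(1) mem(1)] lip[OF mem] lip[OF mem(2) rs(2)] by linarith
qed

text \<open>The \<open>\<eta>\<close> of \<open>N\<close> at \<open>min \<epsilon> 1\<close> also
  serves \<open>M\<close> at \<open>\<epsilon>\<close>: \<open>F \<circ> \<rho>\<close> takes at
  \<open>i p\<close> and \<open>i q\<close> the values of \<open>F\<close> at \<open>p\<close> and
  \<open>q\<close>, and the distances agree, so near-attainment transfers with the same
  constant.\<close>

lemma Lip_BPB_retract:
  assumes "Lip_BPB N z' TYPE('y::banach)"
  shows "Lip_BPB M z TYPE('y)"
  unfolding Lip_BPB_def
proof (intro allI impI)
  fix \<epsilon> :: real
  assume "\<epsilon> > 0"
  \<comment> \<open>The cap at 1 keeps the total displacement of \<open>p\<close> and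
    \<open>q\<close> below their distance even for large \<open>\<epsilon>\<close>, too small for
    both to move to one common point.\<close>
  then have "min \<epsilon> 1 > 0" by simp
  then obtain \<eta> where "\<eta> > 0" and
    N: "\<forall>F \<in> (Lip0 N z' :: ('n \<Rightarrow> 'y) set). lip_norm N F = 1 \<longrightarrow>
      (\<forall>p \<in> mspace N. \<forall>q \<in> mspace N.
         p \<noteq> q \<and> norm (F p - F q) > (1 - \<eta>) * mdist N p q \<longrightarrow>
         (\<exists>G \<in> (Lip0 N z' :: ('n \<Rightarrow> 'y) set). \<exists>r \<in> mspace N. \<exists>s \<in> mspace N. r \<noteq> s \<and>
            norm (G r - G s) / mdist N r s = lip_norm N G \<and> lip_norm N G = 1 \<and>
            lip_norm N (\<lambda>x. G x - F x) < min \<epsilon> 1 \<and>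
            (mdist N p r + mdist N q s) / mdist N p q < min \<epsilon> 1))"
    using assms[unfolded Lip_BPB_def, THEN spec, THEN mp, OF \<open>min \<epsilon> 1 > 0\<close>]
    by (elim exE conjE) (rule that)
  show "\<exists>\<eta>>0. \<forall>F \<in> (Lip0 M z :: ('a \<Rightarrow> 'y) set). lip_norm M F = 1 \<longrightarrow>
    (\<forall>p \<in> mspace M. \<forall>q \<in> mspace M.
       p \<noteq> q \<and> norm (F p - F q) > (1 - \<eta>) * mdist M p q \<longrightarrow>
       (\<exists>G \<in> (Lip0 M z :: ('a \<Rightarrow> 'y) set). \<exists>r \<in> mspace M. \<exists>s \<in> mspace M. r \<noteq> s \<and>
          norm (G r - G s) / mdist M r s = lip_norm M G \<and> lip_norm M G = 1 \<and>
          lip_norm M (\<lambda>x. G x - F x) < \<epsilon> \<and>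
          (mdist M p r + mdist M q s) / mdist M p q < \<epsilon>))"
  proof (intro exI[of _ \<eta>] conjI[OF \<open>\<eta> > 0\<close>] ballI impI)
    fix F :: "'a \<Rightarrow> 'y" and p q
    assume F: "F \<in> Lip0 M z" "lip_norm M F = 1"
      and pq: "p \<in> mspace M" "q \<in> mspace M"
      and near: "p \<noteq> q \<and> norm (F p - F q) > (1 - \<eta>) * mdist M p q"
    have "i p \<noteq> i q"
      using near pq rho_i by metis
    then obtain G r s where G: "G \<in> Lip0 N z'" "lip_norm N G = 1"
      and rs: "r \<in> mspace N" "s \<in> mspace N" "r \<noteq> s"
      and attained: "norm (G r - G s) / mdist N r s = 1"
      and close: "lip_norm N (\<lambda>x. G x - (F \<circ> \<rho>) x) < min \<epsilon> 1"
      and dist: "(mdist N (i p) r + mdist N (i q) s) / mdist N (i p) (i q) < min \<epsilon> 1"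
      using N[rule_format, OF Lip0_extend(1)[OF F(1)], of "i p" "i q"] F near pq
      by (auto simp: lip_norm_extend i_mem rho_i dist_i)
    let ?r = "\<rho> r" and ?s = "\<rho> s"
    have mem: "?r \<in> mspace M" "?s \<in> mspace M"
      using rs by (auto intro: rho_mem)
    have pos: "mdist M p q > 0"
      using near pq mdist_pos by metis
    have "mdist M p ?r \<le> mdist N (i p) r" "mdist M q ?s \<le> mdist N (i q) s"
      using dist_rho[of "i p" r] dist_rho[of "i q" s] rs pq by (simp_all add: i_mem rho_i)
    then have "(mdist M p ?r + mdist M q ?s) / mdist M p q \<le>
        (mdist N (i p) r + mdist N (i q) s) / mdist N (i p) (i q)"
      using pos pq by (simp add: dist_i divide_right_mono)
    then have dist': "(mdist M p ?r + mdist M q ?s) / mdist M p q < min \<epsilon> 1"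
      using dist by linarith
    then have "mdist M p ?r + mdist M q ?s < mdist M p q"
      using pos by simp
    then have ne: "?r \<noteq> ?s"
      using mdist_triangle[OF pq(1) mem(1) pq(2)] mdist_commute[of M] by fastforce
    \<comment> \<open>A quotient equal to 1 rules out a zero denominator, since division by zero
      yields 0.\<close>
    have "norm (G r - G s) = mdist N r s"
      using attained by (auto simp: divide_simps split: if_splits)
    then have eq: "norm ((G \<circ> i) ?r - (G \<circ> i) ?s) = mdist M ?r ?s"
      using norm_attained_rho[OF G rs(1,2) ne] by simp
    have pos': "mdist M ?r ?s > 0"
      using ne mem mdist_pos by metis
    \<comment> \<open>Slope one at the retracted pair bounds the norm of the restriction below by 1;
      restriction does not increase the norm, which gives the other bound.\<close>
    have "mdist M ?r ?s \<le> lip_norm M (G \<circ> i) * mdist M ?r ?s"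
      using norm_diff_le_lip_norm[OF Lip0_restrict(1)[OF G(1)] mem] eq by simp
    then have norm: "lip_norm M (G \<circ> i) = 1"
      using pos' Lip0_restrict(2)[OF G(1)] G(2) by simp
    \<comment> \<open>Since \<open>\<rho> \<circ> i\<close> is the identity on \<open>M\<close>, the
      left function is the restriction along \<open>i\<close> of the right one.\<close>
    have "lip_norm M (\<lambda>x. (G \<circ> i) x - F x) \<le> lip_norm N (\<lambda>x. G x - (F \<circ> \<rho>) x)"
    proof (rule lip_norm_le)
      have diff: "(\<lambda>x. G x - (F \<circ> \<rho>) x) \<in> Lip0 N z'"
        using G(1) Lip0_extend(1)[OF F(1)] by (rule Lip0_diff)
      show "0 \<le> lip_norm N (\<lambda>x. G x - (F \<circ> \<rho>) x)"
        by (rule lip_norm_nonneg[OF diff])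
      fix x y assume "x \<in> mspace M" "y \<in> mspace M"
      then show "norm ((G \<circ> i) x - F x - ((G \<circ> i) y - F y)) \<le>
          lip_norm N (\<lambda>x. G x - (F \<circ> \<rho>) x) * mdist M x y"
        using norm_diff_le_lip_norm[OF diff, of "i x" "i y"] by (simp add: i_mem rho_i dist_i)
    qed
    then have "lip_norm M (\<lambda>x. (G \<circ> i) x - F x) < \<epsilon>"
      using close by linarith
    then show "\<exists>G \<in> (Lip0 M z :: ('a \<Rightarrow> 'y) set). \<exists>r \<in> mspace M. \<exists>s \<in> mspace M. r \<noteq> s \<and>
        norm (G r - G s) / mdist M r s = lip_norm M G \<and> lip_norm M G = 1 \<and>
        lip_norm M (\<lambda>x. G x - F x) < \<epsilon> \<and>
        (mdist M p r + mdist M q s) / mdist M p q < \<epsilon>"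
      using Lip0_restrict(1)[OF G(1)] mem ne eq pos' norm dist'
      by (intro bexI[of _ "G \<circ> i"] bexI[of _ ?r] bexI[of _ ?s]) simp_all
  qed
qed

end

section \<open>The two summands as retracts of the sum\<close>

text \<open>Points with distinct images are not both in the collapsed summand. For points in
  different summands, \<open>split\<close> is the definition of the cross distance through the base
  point; for two points of \<open>M1\<close> the outer terms vanish.\<close>

lemma metric_retract_msum_left:
  assumes "z1 \<in> mspace M1" "z2 \<in> mspace M2"
  shows "metric_retract M1 z1 (msum M1 z1 M2 z2) (Inl z1) Inl (case_sum id (\<lambda>_. z1))"
  using assms
  by unfold_locales
    (auto simp: mspace_msum mdist_msum msum_carrier_def mdist_commute split: sum.splits)

text \<open>The embedding distinguishes cases because \<open>Inr z2\<close> is not in the carrier;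
  the base point of \<open>M2\<close> is represented by \<open>Inl z1\<close>.\<close>

lemma metric_retract_msum_right:
  assumes "z1 \<in> mspace M1" "z2 \<in> mspace M2"
  shows "metric_retract M2 z2 (msum M1 z1 M2 z2) (Inl z1)
    (\<lambda>x. if x = z2 then Inl z1 else Inr x) (case_sum (\<lambda>_. z2) id)"
  using assms
  by unfold_locales
    (auto simp: mspace_msum mdist_msum msum_carrier_def mdist_commute split: sum.splits)

theorem proposition2p2:
  fixes M1 :: "'a metric" and z1 :: 'a
    and M2 :: "'b metric" and z2 :: 'b
  assumes "z1 \<in> mspace M1" and "mcomplete_of M1"
    and "z2 \<in> mspace M2" and "mcomplete_of M2"
    and "Lip_BPB (msum M1 z1 M2 z2) (Inl z1) TYPE('y::banach)"
  shows "Lip_BPB M1 z1 TYPE('y) \<and> Lip_BPB M2 z2 TYPE('y)"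
  using metric_retract.Lip_BPB_retract[OF metric_retract_msum_left[OF assms(1,3)] assms(5)]
    metric_retract.Lip_BPB_retract[OF metric_retract_msum_right[OF assms(1,3)] assms(5)]
  by (rule conjI)

end
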